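(* Assume that $F\in C^3(\mathbb R)$. For any given $\boldsymbol U^{(0)}=\{U_k^{(0)}\}_{k=-1}^{K+1}\in\mathbb R^{K+3}$, let $$B_0:=\left\{\frac2\gamma\left(J_{\rm d}(\boldsymbol U^{(0)})+L\left|\min\left\{\inf_{\xi\in\mathbb R}F(\xi),0\right\}\right|\right)\right\}^{\frac12},\qquad \tilde B_0:=\frac1L\left|M_{\rm d}(\boldsymbol U^{(0)})\right|+L^{\frac12}B_0 .$$ If $\Delta t$ satisfies $$\max\left\{\frac32\max_{|\xi|\le2\tilde B_0}|F''(\xi)|,\ \frac12\max_{|\xi|\le2\tilde B_0}|F''(\xi)|+\frac{5L^{\frac12}B_0}{6}\max_{|\xi|\le2\tilde B_0}|F'''(\xi)|\right\}\sqrt{\frac{\Delta t}{2\gamma}}<1,$$ then there exists a unique solution $\{U_k^{(n)}\}_{k=-1}^{K+1}\in\mathbb R^{K+3}$ $(n=1,2,\ldots)$ satisfying the scheme (S) given in the context with the given initial vector $\boldsymbol U^{(0)}$.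
   Context: Let $L>0$, $\gamma>0$, $K$ a natural number, $\Delta x:=L/K$, and let $\Delta t>0$ be a time mesh size. $F:\mathbb R\to\mathbb R$ is a potential, bounded from below. Difference operators: $\delta_k^+f_k=\frac{f_{k+1}-f_k}{\Delta x}$, $\delta_k^-f_k=\frac{f_k-f_{k-1}}{\Delta x}$, $\delta_k^{\langle1\rangle}f_k=\frac{f_{k+1}-f_{k-1}}{2\Delta x}$, $\delta_k^{\langle2\rangle}f_k=\frac{f_{k+1}-2f_k+f_{k-1}}{(\Delta x)^2}$. Difference quotient: $\frac{dF}{d(\xi,\eta)}:=\frac{F(\xi)-F(\eta)}{\xi-\eta}$ if $\xi\ne\eta$, and $:=F'(\eta)$ if $\xi=\eta$. Discrete mass: $M_{\rm d}(\boldsymbol U):=\Big(\frac12U_0+\sum_{k=1}^{K-1}U_k+\frac12U_K\Big)\Delta x$. Discrete energy: with $G^{\pm}_{{\rm d},k}(\boldsymbol U):=\frac{\gamma}{2}(\delta_k^{\pm}U_k)^2+F(U_k)$, $$J_{\rm d}(\boldsymbol U):=\frac12\Big\{\sum_{k=0}^{K-1}G^+_{{\rm d},k}(\boldsymbol U)\Delta x+\sum_{k=1}^{K}G^-_{{\rm d},k}(\boldsymbol U)\Delta x\Big\}.$$ Scheme (S): for all $n=0,1,\ldots$, (1) $\frac{U_k^{(n+1)}-U_k^{(n)}}{\Delta t}=\delta_k^{\langle2\rangle}P_k^{(n)}$ for $k=0,\ldots,K$; (2) $P_k^{(n)}=-\gamma\,\delta_k^{\langle2\rangle}\Big(\frac{U_k^{(n+1)}+U_k^{(n)}}{2}\Big)+\frac{dF}{d(U_k^{(n+1)},U_k^{(n)})}$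 for $k=0,\ldots,K$; (3) $\frac{U_0^{(n+1)}-U_0^{(n)}}{\Delta t}=\delta_k^{\langle1\rangle}\Big(\frac{U_k^{(n+1)}+U_k^{(n)}}{2}\Big)\Big|_{k=0}$; (4) $\frac{U_K^{(n+1)}-U_K^{(n)}}{\Delta t}=-\delta_k^{\langle1\rangle}\Big(\frac{U_k^{(n+1)}+U_k^{(n)}}{2}\Big)\Big|_{k=K}$; (5) $\delta_k^{\langle1\rangle}P_k^{(n)}=0$ for $k=0,K$. The values $U_{-1}^{(n)},U_{K+1}^{(n)},P_{-1}^{(n)},P_{K+1}^{(n)}$ are artificial (ghost) quantities determined by the discrete boundary conditions; $P_k^{(n)}$ is an auxiliary unknown ($k=-1,\ldots,K+1$). *)

theory Defs
  imports "HOL-Analysis.Analysis"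
begin

text \<open>Grid functions are indexed by \<^typ>\<open>int\<close>, so that the ghost index $-1$ is available. A
  vector $\{U_k\}_{k=-1}^{K+1} \in R^{K+3}$ is an extensional function on $\{-1,\dots,K+1\}$
  (value \<^term>\<open>undefined\<close> elsewhere), so equality of vectors is equality of functions.\<close>

definition grid_vec :: "nat \<Rightarrow> (int \<Rightarrow> real) set" where
  "grid_vec K = {-1..int K + 1} \<rightarrow>\<^sub>E UNIV"

definition mesh :: "real \<Rightarrow> nat \<Rightarrow> real" where
  "mesh L K = L / real K"

definition diff_plus :: "real \<Rightarrow> (int \<Rightarrow> real) \<Rightarrow> int \<Rightarrow> real" where
  "diff_plus h f k = (f (k + 1) - f k) / h"

definition diff_minus :: "real \<Rightarrow> (int \<Rightarrow> real) \<Rightarrow> int \<Rightarrow> real" where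
  "diff_minus h f k = (f k - f (k - 1)) / h"

definition diff_central :: "real \<Rightarrow> (int \<Rightarrow> real) \<Rightarrow> int \<Rightarrow> real" where
  "diff_central h f k = (f (k + 1) - f (k - 1)) / (2 * h)"

definition diff_second :: "real \<Rightarrow> (int \<Rightarrow> real) \<Rightarrow> int \<Rightarrow> real" where
  "diff_second h f k = (f (k + 1) - 2 * f k + f (k - 1)) / h\<^sup>2"

definition diff_quot :: "(real \<Rightarrow> real) \<Rightarrow> real \<Rightarrow> real \<Rightarrow> real" where
  "diff_quot F \<xi> \<eta> = (if \<xi> = \<eta> then deriv F \<eta> else (F \<xi> - F \<eta>) / (\<xi> - \<eta>))"

definition C_cont_diff :: "nat \<Rightarrow> (real \<Rightarrow> real) \<Rightarrow> bool" where
  "C_cont_diff m F \<longleftrightarrow>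
     (\<forall>j<m. (deriv ^^ j) F differentiable_on UNIV) \<and> continuous_on UNIV ((deriv ^^ m) F)"

definition mass_d :: "real \<Rightarrow> nat \<Rightarrow> (int \<Rightarrow> real) \<Rightarrow> real" where
  "mass_d L K U = (U 0 / 2 + (\<Sum>k\<in>{1..int K - 1}. U k) + U (int K) / 2) * mesh L K"

definition energy_dens_plus ::
    "real \<Rightarrow> real \<Rightarrow> (real \<Rightarrow> real) \<Rightarrow> (int \<Rightarrow> real) \<Rightarrow> int \<Rightarrow> real" where
  "energy_dens_plus h \<gamma> F U k = \<gamma> / 2 * (diff_plus h U k)\<^sup>2 + F (U k)"

definition energy_dens_minus ::
    "real \<Rightarrow> real \<Rightarrow> (real \<Rightarrow> real) \<Rightarrow> (int \<Rightarrow> real) \<Rightarrow> int \<Rightarrow> real" where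
  "energy_dens_minus h \<gamma> F U k = \<gamma> / 2 * (diff_minus h U k)\<^sup>2 + F (U k)"

definition energy_d :: "real \<Rightarrow> real \<Rightarrow> nat \<Rightarrow> (real \<Rightarrow> real) \<Rightarrow> (int \<Rightarrow> real) \<Rightarrow> real" where
  "energy_d L \<gamma> K F U =
     1 / 2 * ((\<Sum>k\<in>{0..int K - 1}. energy_dens_plus (mesh L K) \<gamma> F U k * mesh L K)
            + (\<Sum>k\<in>{1..int K}. energy_dens_minus (mesh L K) \<gamma> F U k * mesh L K))"

definition B0 :: "real \<Rightarrow> real \<Rightarrow> nat \<Rightarrow> (real \<Rightarrow> real) \<Rightarrow> (int \<Rightarrow> real) \<Rightarrow> real" where
  "B0 L \<gamma> K F U0 =
     sqrt (2 / \<gamma> * (energy_d L \<gamma> K F U0 + L * \<bar>min (INF \<xi>. F \<xi>) 0\<bar>))"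

definition B0_tilde :: "real \<Rightarrow> real \<Rightarrow> nat \<Rightarrow> (real \<Rightarrow> real) \<Rightarrow> (int \<Rightarrow> real) \<Rightarrow> real" where
  "B0_tilde L \<gamma> K F U0 = 1 / L * \<bar>mass_d L K U0\<bar> + sqrt L * B0 L \<gamma> K F U0"

text \<open>$\max_{|\xi| \le r} |F^{(m)}(\xi)|$; the supremum is attained when $r \ge 0$ and $F^{(m)}$ is
  continuous.\<close>

definition max_abs_deriv :: "nat \<Rightarrow> (real \<Rightarrow> real) \<Rightarrow> real \<Rightarrow> real" where
  "max_abs_deriv m F r = (SUP \<xi>\<in>{\<xi>. \<bar>\<xi>\<bar> \<le> r}. \<bar>(deriv ^^ m) F \<xi>\<bar>)"

definition midpoint_vec :: "(int \<Rightarrow> real) \<Rightarrow> (int \<Rightarrow> real) \<Rightarrow> int \<Rightarrow> real" where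
  "midpoint_vec V U k = (V k + U k) / 2"

text \<open>One time step of the scheme: \<open>U\<close> and \<open>V\<close> are the old and new time levels, \<open>P\<close> is
  the auxiliary unknown.\<close>

definition scheme_step ::
    "real \<Rightarrow> real \<Rightarrow> nat \<Rightarrow> real \<Rightarrow> (real \<Rightarrow> real)
      \<Rightarrow> (int \<Rightarrow> real) \<Rightarrow> (int \<Rightarrow> real) \<Rightarrow> (int \<Rightarrow> real) \<Rightarrow> bool" where
  "scheme_step L \<gamma> K \<Delta>t F U V P \<longleftrightarrow>
     (\<forall>k\<in>{0..int K}. (V k - U k) / \<Delta>t = diff_second (mesh L K) P k) \<and>
     (\<forall>k\<in>{0..int K}.
        P k = - \<gamma> * diff_second (mesh L K) (midpoint_vec V U) k + diff_quot F (V k) (U k)) \<and>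
     (V 0 - U 0) / \<Delta>t = diff_central (mesh L K) (midpoint_vec V U) 0 \<and>
     (V (int K) - U (int K)) / \<Delta>t = - diff_central (mesh L K) (midpoint_vec V U) (int K) \<and>
     (\<forall>k\<in>{0, int K}. diff_central (mesh L K) P k = 0)"

definition scheme ::
    "real \<Rightarrow> real \<Rightarrow> nat \<Rightarrow> real \<Rightarrow> (real \<Rightarrow> real)
      \<Rightarrow> (nat \<Rightarrow> int \<Rightarrow> real) \<Rightarrow> (nat \<Rightarrow> int \<Rightarrow> real) \<Rightarrow> bool" where
  "scheme L \<gamma> K \<Delta>t F U P \<longleftrightarrow> (\<forall>n. scheme_step L \<gamma> K \<Delta>t F (U n) (U (Suc n)) (P n))"

end

theory Submission
  imports Defs
begin

text \<open>Summation by parts turns one step of the scheme into the identity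
  \<open>\<tau> |P|\<^sup>2 + \<gamma> (W, D) + (\<gamma> / \<tau>) (D\<^sub>0\<^sup>2 + D\<^sub>K\<^sup>2) + \<langle>r, D\<rangle> = 0\<close> between Dirichlet forms of the potential \<open>P\<close>,
  the midpoint \<open>W\<close> and the increment \<open>D\<close>, the trapezoidal product \<open>\<langle>r, D\<rangle>\<close> with the difference
  quotient \<open>r\<close>, and boundary terms. With \<open>\<langle>r, D\<rangle>\<close> equal to the increment of the potential energy it
  gives energy decay, hence gradient and supremum bounds for all solutions. Applied to the
  difference of two solutions it shows, since \<open>\<langle>D, D\<rangle> = - \<tau> (P, D)\<close>, that the step with frozen
  difference quotient depends on that quotient contractively. This yields uniqueness and, after
  truncating the quotient at twice the a priori bound, existence by successive approximation. The
  same identity bounds the gradient of the new level by twice that of the old one, so the fixed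
  point stays inside the truncation.\<close>

section \<open>Discrete calculus: trapezoidal sums, Dirichlet forms, summation by parts\<close>

text \<open>The trapezoidal rule is written cell by cell, so that it shares its index set with
  \<open>dirichlet\<close> and an induction on \<open>K\<close> adds exactly one cell.\<close>

definition trap :: "real \<Rightarrow> nat \<Rightarrow> (int \<Rightarrow> real) \<Rightarrow> real" where
  "trap h K f = (\<Sum>k<K. h * (f (int k) + f (int k + 1)) / 2)"

definition dirichlet :: "real \<Rightarrow> nat \<Rightarrow> (int \<Rightarrow> real) \<Rightarrow> (int \<Rightarrow> real) \<Rightarrow> real" where
  "dirichlet h K f g = (\<Sum>k<K. h * diff_plus h f (int k) * diff_plus h g (int k))"

lemma trap_add: "trap h K (\<lambda>k. f k + g k) = trap h K f + trap h K g"
  unfolding trap_def sum.distrib[symmetric] by (rule sum.cong) (auto simp: field_simps)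

lemma trap_diff: "trap h K (\<lambda>k. f k - g k) = trap h K f - trap h K g"
  unfolding trap_def sum_subtractf[symmetric] by (rule sum.cong) (auto simp: field_simps)

lemma trap_cmult: "trap h K (\<lambda>k. c * f k) = c * trap h K f"
  unfolding trap_def sum_distrib_left by (rule sum.cong) (auto simp: field_simps)

lemma trap_cong: "(\<And>k. k \<in> {0..int K} \<Longrightarrow> f k = g k) \<Longrightarrow> trap h K f = trap h K g"
  unfolding trap_def by (rule sum.cong) auto

lemma trap_mono:
  assumes "0 \<le> h" and "\<And>k. k \<in> {0..int K} \<Longrightarrow> f k \<le> g k"
  shows "trap h K f \<le> trap h K g"
  unfolding trap_def using assms
  by (intro sum_mono divide_right_mono mult_left_mono add_mono) auto

lemma trap_abs:
  assumes "0 \<le> h"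
  shows "\<bar>trap h K f\<bar> \<le> trap h K (\<lambda>k. \<bar>f k\<bar>)"
proof -
  have "trap h K f \<le> trap h K (\<lambda>k. \<bar>f k\<bar>)" "trap h K (\<lambda>k. - 1 * f k) \<le> trap h K (\<lambda>k. \<bar>f k\<bar>)"
    using assms by (auto intro!: trap_mono)
  then show ?thesis by (simp only: trap_cmult)
qed

lemma trap_const: "trap h K (\<lambda>k. c) = h * real K * c"
  unfolding trap_def by simp

text \<open>Every node is an end of at least one cell and so carries weight at least
  \<open>h / 2\<close>. This turns control of a sum of squares into pointwise control.\<close>

lemma trap_ge_single:
  assumes "0 \<le> h" "K \<ge> 1" "j \<in> {0..int K}" and nn: "\<And>k. k \<in> {0..int K} \<Longrightarrow> 0 \<le> f k"
  shows "h / 2 * f j \<le> trap h K f"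
proof -
  \<comment> \<open>The last node has no cell to its right and is assigned the cell to its
    left.\<close>
  define i where "i = (if j = int K then K - 1 else nat j)"
  have i: "i < K" "j = int i \<or> j = int i + 1"
    using assms by (auto simp: i_def)
  have "h / 2 * f j \<le> h * (f (int i) + f (int i + 1)) / 2"
    using i nn[of "int i"] nn[of "int i + 1"] assms(1)
    by (auto simp: distrib_left)
  also have "\<dots> \<le> trap h K f"
    unfolding trap_def using i nn assms(1)
    by (intro member_le_sum[where f = "\<lambda>k. h * (f (int k) + f (int k + 1)) / 2"]) auto
  finally show ?thesis .
qed

lemma dirichlet_nonneg: "0 \<le> h \<Longrightarrow> 0 \<le> dirichlet h K f f"
  unfolding dirichlet_def by (intro sum_nonneg) (simp add: mult.assoc)

text \<open>On a single cell the identity is algebra, with central differences at the two ends as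
  boundary terms; at interior nodes these cancel between neighbouring cells. Ghost values enter
  through \<open>f\<close> only, while \<open>g\<close> is read at the nodes \<open>0\<close> to
  \<open>K\<close>.\<close>

lemma summation_by_parts:
  assumes "h \<noteq> 0"
  shows "trap h K (\<lambda>k. diff_second h f k * g k) = - dirichlet h K f g
     + diff_central h f (int K) * g (int K) - diff_central h f 0 * g 0"
proof (induction K)
  case 0
  then show ?case by (simp add: trap_def dirichlet_def)
next
  case (Suc n)
  have "h * (diff_second h f (int n) * g (int n) + diff_second h f (int n + 1) * g (int n + 1)) / 2
      = - (h * diff_plus h f (int n) * diff_plus h g (int n))
        + diff_central h f (int n + 1) * g (int n + 1) - diff_central h f (int n) * g (int n)"
    using assms unfolding diff_second_def diff_plus_def diff_central_def
    by (simp add: field_simps power2_eq_square)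
  then show ?case
    using Suc unfolding trap_def dirichlet_def sum.lessThan_Suc of_nat_Suc add.commute[of 1]
    by linarith
qed

section \<open>Mass, energy and the supremum bound\<close>

lemma trap_eq_mass: "K \<ge> 1 \<Longrightarrow> mass_d L K U = trap (mesh L K) K U"
proof -
  have "(\<Sum>k<n. (f (int k) + f (int k + 1)) / 2)
      = f 0 / 2 + (\<Sum>k\<in>{1..int n - 1}. f k) + f (int n) / 2" if "n \<ge> 1" for n and f :: "int \<Rightarrow> real"
    using that
  proof (induction n rule: nat_induct_at_least)
    case base
    then show ?case by (simp add: field_simps)
  next
    case (Suc n)
    have "{1..int (Suc n) - 1} = insert (int n) {1..int n - 1}" using Suc by auto
    then show ?case using Suc by (simp add: field_simps)
  qed
  from this[of K U] show "K \<ge> 1 \<Longrightarrow> mass_d L K U = trap (mesh L K) K U"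
    unfolding mass_d_def trap_def times_divide_eq_right[symmetric] sum_distrib_left[symmetric]
    by simp
qed

text \<open>After reindexing, the forward and backward differences are the same difference on each
  cell, and the values of \<open>F\<close> at its two ends average to the trapezoidal rule.\<close>

lemma energy_eq:
  "energy_d L \<gamma> K F U
    = \<gamma> / 2 * dirichlet (mesh L K) K U U + trap (mesh L K) K (\<lambda>k. F (U k))"
proof -
  let ?h = "mesh L K"
  have 1: "(\<Sum>k\<in>{0..int K - 1}. f k) = (\<Sum>k<K. f (int k))" for f :: "int \<Rightarrow> real"
    by (rule sum.reindex_bij_witness[of _ int nat]) auto
  have 2: "(\<Sum>k\<in>{1..int K}. f k) = (\<Sum>k<K. f (int k + 1))" for f :: "int \<Rightarrow> real"
    by (rule sum.reindex_bij_witness[of _ "\<lambda>k. int k + 1" "\<lambda>k. nat (k - 1)"]) auto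
  show ?thesis
    unfolding energy_d_def 1 2 dirichlet_def trap_def energy_dens_plus_def energy_dens_minus_def
      diff_plus_def diff_minus_def sum_distrib_left sum.distrib[symmetric]
    by (rule sum.cong; cases "mesh L K = 0") (auto simp: field_simps power2_eq_square)
qed

text \<open>Telescoping between the two nodes and Cauchy-Schwarz: the discrete one-dimensional
  Sobolev inequality.\<close>

lemma oscillation_bound:
  assumes "h > 0" "i \<in> {0..int K}" "j \<in> {0..int K}"
  shows "\<bar>U j - U i\<bar> \<le> sqrt (h * real K * dirichlet h K U U)"
proof -
  let ?d = "\<lambda>k. U (int k + 1) - U (int k)"
  have tele: "U (int n) - U (int m) = (\<Sum>k\<in>{m..<n}. ?d k)" if "m \<le> n" for m n
    using sum_Suc_diff'[OF that, of "\<lambda>k. U (int k)"] by (simp add: add.commute)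
  have le0: "\<bar>U (int n) - U (int m)\<bar> \<le> (\<Sum>k<K. \<bar>?d k\<bar>)" if "m \<le> n" "n \<le> K" for m n
    unfolding tele[OF that(1)]
    using that by (intro order_trans[OF sum_abs] sum_mono2) auto
  then have le: "\<bar>U j - U i\<bar> \<le> (\<Sum>k<K. \<bar>?d k\<bar>)"
  proof -
    obtain m n where "i = int m" "j = int n" "m \<le> K" "n \<le> K"
      using assms(2,3) by (auto dest!: zero_le_imp_eq_int)
    then show ?thesis
      using le0[of m n] le0[of n m] by (cases "m \<le> n") (auto simp: abs_minus_commute)
  qed
  have "(\<Sum>k<K. \<bar>?d k\<bar>)\<^sup>2 \<le> (\<Sum>k<K. \<bar>?d k\<bar>\<^sup>2) * card {..<K}"
    by (rule sum_squared_le_sum_of_squares)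
  also have "\<dots> = h * real K * dirichlet h K U U"
    unfolding dirichlet_def diff_plus_def sum_distrib_left sum_distrib_right using assms(1)
    by (intro sum.cong) (simp_all add: field_simps power2_eq_square)
  finally show ?thesis
    using le by (meson order_trans real_le_rsqrt)
qed

text \<open>Averaging \<open>U j - U k\<close> over \<open>k\<close> shows that a nodal value
  differs from the mean by at most the oscillation.\<close>

lemma sup_bound:
  assumes "h > 0" "K \<ge> 1" "j \<in> {0..int K}"
  shows "\<bar>U j\<bar> \<le> \<bar>trap h K U\<bar> / (h * real K) + sqrt (h * real K * dirichlet h K U U)"
proof -
  let ?L = "h * real K" and ?s = "sqrt (h * real K * dirichlet h K U U)"
  have L: "?L > 0" using assms by simp
  have "?L * U j = trap h K (\<lambda>k. U j)" by (simp add: trap_const)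
  also have "\<dots> = trap h K U + trap h K (\<lambda>k. U j - U k)"
    by (simp add: trap_diff)
  finally have "\<bar>?L * U j\<bar> \<le> \<bar>trap h K U\<bar> + \<bar>trap h K (\<lambda>k. U j - U k)\<bar>" by linarith
  also have "\<bar>trap h K (\<lambda>k. U j - U k)\<bar> \<le> trap h K (\<lambda>k. ?s)"
    using oscillation_bound[OF assms(1) _ assms(3)] assms
    by (intro order_trans[OF trap_abs] trap_mono) auto
  also have "\<dots> = ?L * ?s" by (simp only: trap_const)
  finally have "?L * \<bar>U j\<bar> \<le> \<bar>trap h K U\<bar> + ?L * ?s"
    using assms(1) by (simp add: abs_mult)
  then show ?thesis using L assms(1,2) by (simp add: pos_le_divide_eq add_divide_distrib[symmetric] add_divide_eq_iff field_simps)
qed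

section \<open>Identities and estimates for the step with frozen difference quotient\<close>

text \<open>A time step with the difference quotient frozen to a given grid function \<open>r\<close>: \<open>D\<close> is the
  increment and \<open>W\<close> the grid function to which the Laplacian and the dynamic boundary condition
  are applied (the midpoint in the scheme, half the increment for differences of solutions).\<close>

definition lin_step ::
    "real \<Rightarrow> real \<Rightarrow> real \<Rightarrow> nat \<Rightarrow> (int \<Rightarrow> real) \<Rightarrow> (int \<Rightarrow> real) \<Rightarrow> (int \<Rightarrow> real) \<Rightarrow> (int \<Rightarrow> real) \<Rightarrow> bool" where
  "lin_step h \<gamma> \<tau> K r W D P \<longleftrightarrow>
     (\<forall>k\<in>{0..int K}. D k = \<tau> * diff_second h P k) \<and>
     (\<forall>k\<in>{0..int K}. P k = - \<gamma> * diff_second h W k + r k) \<and>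
     D 0 = \<tau> * diff_central h W 0 \<and>
     D (int K) = - \<tau> * diff_central h W (int K) \<and>
     (\<forall>k\<in>{0, int K}. diff_central h P k = 0)"

lemma lin_step_diff:
  assumes "lin_step h \<gamma> \<tau> K r W D P" "lin_step h \<gamma> \<tau> K r' W' D' P'"
  shows "lin_step h \<gamma> \<tau> K (\<lambda>k. r k - r' k) (\<lambda>k. W k - W' k) (\<lambda>k. D k - D' k) (\<lambda>k. P k - P' k)"
proof -
  have 1: "diff_second h (\<lambda>k. f k - g k) k = diff_second h f k - diff_second h g k" for f g k
    by (simp add: diff_second_def diff_divide_distrib add_divide_distrib algebra_simps)
  have 2: "diff_central h (\<lambda>k. f k - g k) k = diff_central h f k - diff_central h g k" for f g k
    by (simp add: diff_central_def diff_divide_distrib add_divide_distrib algebra_simps)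
  show ?thesis
    using assms unfolding lin_step_def 1 2 by (simp add: algebra_simps)
qed

lemma lin_step_cong:
  assumes "\<And>k. k \<in> {0..int K} \<Longrightarrow> r k = r' k"
    and "\<And>k. k \<in> {-1..int K + 1} \<Longrightarrow> W k = W' k"
    and "\<And>k. k \<in> {0..int K} \<Longrightarrow> D k = D' k"
    and "\<And>k. k \<in> {-1..int K + 1} \<Longrightarrow> P k = P' k"
  shows "lin_step h \<gamma> \<tau> K r W D P \<longleftrightarrow> lin_step h \<gamma> \<tau> K r' W' D' P'"
  using assms unfolding lin_step_def diff_second_def diff_central_def by simp

text \<open>Summation by parts on \<open>P\<close> leaves no boundary terms, since the central
  differences of \<open>P\<close> vanish at both ends.\<close>

lemma lin_step_trap_increment:
  assumes "h \<noteq> 0" "lin_step h \<gamma> \<tau> K r W D P"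
  shows "trap h K (\<lambda>k. D k * g k) = - \<tau> * dirichlet h K P g"
proof -
  have "trap h K (\<lambda>k. D k * g k) = trap h K (\<lambda>k. \<tau> * (diff_second h P k * g k))"
    using assms(2) by (intro trap_cong) (auto simp: lin_step_def)
  then show ?thesis
    using assms(2) by (simp add: trap_cmult summation_by_parts[OF assms(1)] lin_step_def)
qed

lemma lin_step_mass:
  assumes "h \<noteq> 0" "lin_step h \<gamma> \<tau> K r W D P"
  shows "trap h K D = 0"
  using lin_step_trap_increment[OF assms, of "\<lambda>_. 1"] by (simp add: dirichlet_def diff_plus_def)

text \<open>The increment is paired with \<open>P\<close> in two ways: by summation by parts, and by
  inserting the equation for \<open>P\<close>. The dynamic boundary conditions turn both boundary
  terms into squares of the same sign.\<close>

lemma lin_step_energy: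
  assumes "h \<noteq> 0" "\<tau> > 0" "lin_step h \<gamma> \<tau> K r W D P"
  shows "\<tau> * dirichlet h K P P + \<gamma> * dirichlet h K W D
    + \<gamma> / \<tau> * ((D 0)\<^sup>2 + (D (int K))\<^sup>2) + trap h K (\<lambda>k. r k * D k) = 0"
proof -
  have c: "diff_central h W 0 = D 0 / \<tau>" "diff_central h W (int K) = - D (int K) / \<tau>"
    using assms(2,3) by (auto simp: lin_step_def)
  have "- \<tau> * dirichlet h K P P = trap h K (\<lambda>k. D k * P k)"
    using lin_step_trap_increment[OF assms(1,3), of P] by simp
  also have "\<dots> = trap h K (\<lambda>k. - \<gamma> * (diff_second h W k * D k) + r k * D k)"
  proof (rule trap_cong)
    fix k assume "k \<in> {0..int K}"
    then have "P k = - \<gamma> * diff_second h W k + r k" using assms(3) by (simp add: lin_step_def)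
    then show "D k * P k = - \<gamma> * (diff_second h W k * D k) + r k * D k"
      by (simp only:) (simp add: algebra_simps)
  qed
  also have "\<dots> = \<gamma> * dirichlet h K W D + \<gamma> / \<tau> * ((D 0)\<^sup>2 + (D (int K))\<^sup>2) + trap h K (\<lambda>k. r k * D k)"
    unfolding trap_add trap_cmult summation_by_parts[OF assms(1)] c
    by (simp add: algebra_simps power2_eq_square)
  finally show ?thesis by linarith
qed

lemma lin_step_stable:
  assumes "h > 0" "K \<ge> 1" "\<tau> > 0" "\<gamma> > 0" "M \<ge> 0"
    and small: "3 / 2 * M * sqrt (\<tau> / (2 * \<gamma>)) < 1"
    and step: "lin_step h \<gamma> \<tau> K r (\<lambda>k. E k / 2) E Q"
    and r: "\<And>k. k \<in> {0..int K} \<Longrightarrow> \<bar>r k\<bar> \<le> M / 2 * \<bar>x k\<bar>"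
  shows "trap h K (\<lambda>k. (E k)\<^sup>2) \<le> 1 / 5 * trap h K (\<lambda>k. (x k)\<^sup>2)"
proof -
  let ?s = "sqrt (\<tau> / (2 * \<gamma>))"
  let ?X = "trap h K (\<lambda>k. (x k)\<^sup>2)" and ?E = "trap h K (\<lambda>k. (E k)\<^sup>2)"
  have s: "?s > 0" "?s * ?s = \<tau> / (2 * \<gamma>)" using assms by simp_all
  have X: "?X \<ge> 0" and EE: "?E \<ge> 0"
    using trap_mono[of h K "\<lambda>_. 0"] assms(1) by (auto simp: trap_const)
  have half: "dirichlet h K (\<lambda>k. E k / 2) E = 1 / 2 * dirichlet h K E E"
    unfolding dirichlet_def sum_distrib_left diff_plus_def
    by (rule sum.cong) (auto simp: field_simps)
  have "0 \<le> \<gamma> / \<tau> * ((E 0)\<^sup>2 + (E (int K))\<^sup>2)" using assms by simp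
  then have en: "\<tau> * dirichlet h K Q Q + \<gamma> / 2 * dirichlet h K E E \<le> \<bar>trap h K (\<lambda>k. r k * E k)\<bar>"
    using lin_step_energy[OF _ assms(3) step] assms(1) unfolding half by linarith
  \<comment> \<open>Young's inequality with exactly the weights of the energy identity: twice the
    geometric mean of \<tau> and \<gamma> / 2, times \<open>?s\<close>, equals \<tau>.\<close>
  have pt: "- \<tau> * (a * b) \<le> ?s * (\<tau> * (a * a) + \<gamma> / 2 * (b * b))" for a b :: real
  proof -
    have "0 \<le> (2 * \<gamma>) * (?s * a + b / 2)\<^sup>2" using assms(4) by simp
    also have "\<dots> = \<tau> * (a * a) + 2 * \<gamma> * ?s * (a * b) + \<gamma> / 2 * (b * b)"
    proof -
      have "(2 * \<gamma>) * (?s * a + b / 2)\<^sup>2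
          = 2 * \<gamma> * (?s * ?s) * (a * a) + 2 * \<gamma> * ?s * (a * b) + \<gamma> / 2 * (b * b)"
        by (simp add: power2_eq_square algebra_simps)
      then show ?thesis unfolding s(2) using assms(4) by simp
    qed
    finally have "0 \<le> ?s * (\<tau> * (a * a) + 2 * \<gamma> * ?s * (a * b) + \<gamma> / 2 * (b * b))"
      using s(1) by simp
    also have "\<dots> = ?s * (\<tau> * (a * a) + \<gamma> / 2 * (b * b)) + 2 * \<gamma> * (?s * ?s) * (a * b)"
      by (simp add: algebra_simps)
    also have "\<dots> = ?s * (\<tau> * (a * a) + \<gamma> / 2 * (b * b)) + \<tau> * (a * b)"
      unfolding s(2) using assms(4) by simp
    finally show ?thesis by simp
  qed
  have "?E = trap h K (\<lambda>k. E k * E k)" by (simp add: power2_eq_square)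
  also have "\<dots> = - \<tau> * dirichlet h K Q E"
    using lin_step_trap_increment[OF _ step] assms(1) by simp
  also have "\<dots> = (\<Sum>k<K. h * (- \<tau> * (diff_plus h Q (int k) * diff_plus h E (int k))))"
    unfolding dirichlet_def sum_distrib_left by (rule sum.cong) auto
  also have "\<dots> \<le> (\<Sum>k<K. h * (?s * (\<tau> * (diff_plus h Q (int k) * diff_plus h Q (int k))
      + \<gamma> / 2 * (diff_plus h E (int k) * diff_plus h E (int k)))))"
    using pt assms(1) by (intro sum_mono mult_left_mono) auto
  also have "\<dots> = ?s * (\<tau> * dirichlet h K Q Q + \<gamma> / 2 * dirichlet h K E E)"
    unfolding dirichlet_def sum_distrib_left sum.distrib[symmetric]
    by (rule sum.cong) (auto simp: algebra_simps)
  also have "\<dots> \<le> ?s * \<bar>trap h K (\<lambda>k. r k * E k)\<bar>"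
    using en s(1) by simp
  also have "\<bar>trap h K (\<lambda>k. r k * E k)\<bar> \<le> trap h K (\<lambda>k. M / 4 * ((x k)\<^sup>2 + (E k)\<^sup>2))"
  proof (rule order_trans[OF trap_abs trap_mono])
    fix k assume k: "k \<in> {0..int K}"
    have "\<bar>r k * E k\<bar> \<le> M / 2 * \<bar>x k\<bar> * \<bar>E k\<bar>"
      unfolding abs_mult by (intro mult_right_mono r k) auto
    also have "\<dots> = M / 2 * (\<bar>x k\<bar> * \<bar>E k\<bar>)" by simp
    also have "\<dots> \<le> M / 2 * (((x k)\<^sup>2 + (E k)\<^sup>2) / 2)"
      using sum_squares_bound[of "\<bar>x k\<bar>" "\<bar>E k\<bar>"] assms(5)
      by (intro mult_left_mono) auto
    finally show "\<bar>r k * E k\<bar> \<le> M / 4 * ((x k)\<^sup>2 + (E k)\<^sup>2)" by simp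
  qed (use assms in auto)
  also have "\<dots> = M / 4 * (?X + ?E)" by (simp only: trap_cmult trap_add)
  finally have "?E \<le> ?s * (M / 4 * (?X + ?E))" using s(1) by simp
  \<comment> \<open>The factor 3 / 2 of the smallness condition leaves 1 / 6 here, and absorbing the
    term \<open>?E / 6\<close> on the left gives 1 / 5.\<close>
  also have "\<dots> = (3 / 2 * M * ?s) * ((?X + ?E) / 6)" by simp
  also have "\<dots> \<le> 1 * ((?X + ?E) / 6)"
    using small X EE by (intro mult_right_mono) auto
  finally show ?thesis by simp
qed

text \<open>On each cell this is (a + b) / 2 * (a - b): averaging the two time levels makes the
  increment of the gradient energy exact.\<close>

lemma dirichlet_midpoint:
  "dirichlet h K (midpoint_vec V U) (\<lambda>k. V k - U k)
    = 1 / 2 * (dirichlet h K V V - dirichlet h K U U)"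
proof -
  have *: "diff_plus h (midpoint_vec V U) k * diff_plus h (\<lambda>k. V k - U k) k
      = 1 / 2 * (diff_plus h V k * diff_plus h V k - diff_plus h U k * diff_plus h U k)" for k
  proof -
    have "diff_plus h (midpoint_vec V U) k = (diff_plus h V k + diff_plus h U k) / 2"
      and "diff_plus h (\<lambda>k. V k - U k) k = diff_plus h V k - diff_plus h U k"
      by (simp_all add: diff_plus_def midpoint_vec_def add_divide_distrib diff_divide_distrib)
    then show ?thesis by (simp only:) (simp add: field_simps)
  qed
  show ?thesis
    unfolding dirichlet_def sum_distrib_left sum_subtractf[symmetric] mult.assoc *
    by (intro sum.cong) (simp_all add: algebra_simps)
qed

lemma lin_step_gradient_bound:
  assumes "h > 0" "\<tau> > 0" "\<gamma> > 0" "M \<ge> 0"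
    and small: "3 / 2 * M * sqrt (\<tau> / (2 * \<gamma>)) < 1"
    and step: "lin_step h \<gamma> \<tau> K r (midpoint_vec V U) (\<lambda>k. V k - U k) P"
    and r: "\<And>k. k \<in> {0..<int K} \<Longrightarrow>
      \<bar>r (k + 1) - r k\<bar> \<le> M / 2 * (\<bar>V (k + 1) - V k\<bar> + \<bar>U (k + 1) - U k\<bar>)"
  shows "dirichlet h K V V \<le> 4 * dirichlet h K U U"
proof -
  let ?D = "\<lambda>k. V k - U k"
  let ?v = "dirichlet h K V V" and ?u = "dirichlet h K U U"
  have nn: "?v \<ge> 0" "?u \<ge> 0" using assms(1) by (auto intro: dirichlet_nonneg)
  have "0 \<le> \<gamma> / \<tau> * ((?D 0)\<^sup>2 + (?D (int K))\<^sup>2)" using assms by simp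
  moreover have "trap h K (\<lambda>k. r k * ?D k) = - \<tau> * dirichlet h K P r"
    using lin_step_trap_increment[OF _ step, of r] assms(1) by (simp add: mult.commute)
  ultimately have "\<gamma> / 2 * (?v - ?u) \<le> \<tau> * dirichlet h K P r - \<tau> * dirichlet h K P P"
    using lin_step_energy[OF _ assms(2) step] assms(1) unfolding dirichlet_midpoint by (simp add: algebra_simps)
  also have "\<dots> = (\<Sum>k<K. \<tau> * h * (diff_plus h P (int k) * diff_plus h r (int k)
      - diff_plus h P (int k) * diff_plus h P (int k)))"
    unfolding dirichlet_def sum_distrib_left sum_subtractf[symmetric]
    by (rule sum.cong) (auto simp: algebra_simps)
  also have "\<dots> \<le> (\<Sum>k<K. \<tau> * h * (M\<^sup>2 / 8 * ((diff_plus h V (int k))\<^sup>2 + (diff_plus h U (int k))\<^sup>2)))"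
  proof (intro sum_mono mult_left_mono)
    fix k assume "k \<in> {..<K}"
    then have "\<bar>r (int k + 1) - r (int k)\<bar> / h
        \<le> M / 2 * (\<bar>V (int k + 1) - V (int k)\<bar> + \<bar>U (int k + 1) - U (int k)\<bar>) / h"
      using r[of "int k"] assms(1) by (intro divide_right_mono) auto
    then have "\<bar>diff_plus h r (int k)\<bar> \<le> M / 2 * (\<bar>diff_plus h V (int k)\<bar> + \<bar>diff_plus h U (int k)\<bar>)"
      using assms(1) by (simp add: diff_plus_def add_divide_distrib[symmetric])
    then have "(diff_plus h r (int k))\<^sup>2 \<le> (M / 2 * (\<bar>diff_plus h V (int k)\<bar> + \<bar>diff_plus h U (int k)\<bar>))\<^sup>2"
      using abs_le_square_iff by fastforce
    also have "\<dots> = M\<^sup>2 / 4 * (\<bar>diff_plus h V (int k)\<bar> + \<bar>diff_plus h U (int k)\<bar>)\<^sup>2"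
      by (simp add: power_mult_distrib power_divide)
    also have "\<dots> \<le> M\<^sup>2 / 4 * (2 * ((diff_plus h V (int k))\<^sup>2 + (diff_plus h U (int k))\<^sup>2))"
      using sum_squares_bound[of "\<bar>diff_plus h V (int k)\<bar>" "\<bar>diff_plus h U (int k)\<bar>"]
      by (intro mult_left_mono) (auto simp: power2_sum)
    finally have 1: "(diff_plus h r (int k))\<^sup>2
        \<le> M\<^sup>2 / 2 * ((diff_plus h V (int k))\<^sup>2 + (diff_plus h U (int k))\<^sup>2)" by (simp add: algebra_simps)
    \<comment> \<open>Completing the square eliminates \<open>P\<close>, for which no separate bound
      is at hand.\<close>
    have "0 \<le> (diff_plus h P (int k) - diff_plus h r (int k) / 2)\<^sup>2" by simp
    then have "diff_plus h P (int k) * diff_plus h r (int k)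
        - diff_plus h P (int k) * diff_plus h P (int k) \<le> (diff_plus h r (int k))\<^sup>2 / 4"
      by (simp add: power2_eq_square algebra_simps)
    with 1 show "diff_plus h P (int k) * diff_plus h r (int k)
        - diff_plus h P (int k) * diff_plus h P (int k)
      \<le> M\<^sup>2 / 8 * ((diff_plus h V (int k))\<^sup>2 + (diff_plus h U (int k))\<^sup>2)" by linarith
  qed (use assms in auto)
  also have "\<dots> = \<tau> * M\<^sup>2 / 8 * (?v + ?u)"
    unfolding dirichlet_def sum_distrib_left sum.distrib[symmetric]
    by (rule sum.cong) (auto simp: algebra_simps power2_eq_square)
  finally have 1: "\<gamma> / 2 * (?v - ?u) \<le> \<tau> * M\<^sup>2 / 8 * (?v + ?u)" .
  have "(3 / 2 * M * sqrt (\<tau> / (2 * \<gamma>)))\<^sup>2 \<le> 1"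
    using small assms(2-4) by (intro power_le_one) auto
  then have "9 * M\<^sup>2 * \<tau> \<le> 8 * \<gamma>"
    using assms(2,3) by (simp add: power_mult_distrib power_divide field_simps)
  then have "9 * M\<^sup>2 * \<tau> * (?v + ?u) \<le> 8 * \<gamma> * (?v + ?u)" using nn by (intro mult_right_mono) auto
  with 1 have "\<gamma> * (36 * (?v - ?u)) \<le> \<gamma> * (8 * (?v + ?u))" by (simp add: algebra_simps)
  \<comment> \<open>Hence 28 \<open>?v\<close> is at most 44 \<open>?u\<close>. The weaker factor 4,
    that is 2 for the gradient norm, already matches a truncation at twice the a priori
    bound.\<close>
  then have "36 * (?v - ?u) \<le> 8 * (?v + ?u)" using assms(3) by simp
  then show ?thesis using nn by simp
qed

section \<open>Linear algebra: injective square systems are solvable\<close>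

text \<open>Gaussian elimination by induction on the equations: a zero equation is dropped, any
  other one has a pivot \<open>p\<close> and is used to eliminate the unknown \<open>p\<close> from
  the rest.\<close>

lemma underdetermined_system_nontrivial_solution:
  fixes A :: "'b \<Rightarrow> 'a \<Rightarrow> 'c::field"
  assumes "finite J" "finite I" "card J < card I"
  shows "\<exists>x. (\<exists>i\<in>I. x i \<noteq> 0) \<and> (\<forall>j\<in>J. (\<Sum>i\<in>I. A j i * x i) = 0)"
  using assms
proof (induction J arbitrary: I A rule: finite_induct)
  case empty
  then obtain i where "i \<in> I" by fastforce
  then show ?case by (intro exI[of _ "\<lambda>_. 1"]) auto
next
  case (insert j J)
  show ?case
  proof (cases "\<forall>i\<in>I. A j i = 0")
    case True
    have "card J < card I" using insert by simp
    with insert.IH[OF insert.prems(1), of A] True show ?thesis by auto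
  next
    case False
    then obtain p where p: "p \<in> I" "A j p \<noteq> 0" by auto
    let ?I = "I - {p}"
    have "card J < card ?I" using insert p by simp
    with insert.IH[of ?I "\<lambda>j' i. A j' i - A j' p * A j i / A j p"] insert.prems(1)
    obtain y where y: "\<exists>i\<in>?I. y i \<noteq> 0"
      and yJ: "\<forall>j'\<in>J. (\<Sum>i\<in>?I. (A j' i - A j' p * A j i / A j p) * y i) = 0" by auto
    define x where "x = y(p := - (\<Sum>i\<in>?I. A j i * y i) / A j p)"
    have sum: "(\<Sum>i\<in>I. A j' i * x i)
        = (\<Sum>i\<in>?I. A j' i * y i) - A j' p * (\<Sum>i\<in>?I. A j i * y i) / A j p" for j'
      using insert.prems(1) p by (simp add: sum.remove[of I p] x_def)
    have "(\<Sum>i\<in>I. A j' i * x i) = 0" if "j' \<in> insert j J" for j'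
    proof (cases "j' = j")
      case True
      then show ?thesis using sum p by simp
    next
      case False
      have "(\<Sum>i\<in>I. A j' i * x i) = (\<Sum>i\<in>?I. (A j' i - A j' p * A j i / A j p) * y i)"
        unfolding sum sum_distrib_left sum_divide_distrib sum_subtractf[symmetric]
        by (rule sum.cong) (auto simp: algebra_simps)
      then show ?thesis using yJ False that by auto
    qed
    moreover have "\<exists>i\<in>I. x i \<noteq> 0" using y by (auto simp: x_def)
    ultimately show ?thesis by blast
  qed
qed

text \<open>The right-hand side is adjoined with a minus sign as an extra column, indexed by
  \<open>None\<close>, which gives one unknown more than equations. By injectivity that coordinate
  of a nontrivial solution is nonzero, and dividing by it solves the system.\<close>

lemma linear_injective_imp_solvable:
  fixes \<Phi> :: "('a \<Rightarrow> 'c::field) \<Rightarrow> 'a \<Rightarrow> 'c"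
  assumes "finite I"
    and linear: "\<And>x y c i. \<Phi> (\<lambda>i. x i + c * y i) i = \<Phi> x i + c * \<Phi> y i"
    and inj: "\<And>x. (\<And>i. i \<in> I \<Longrightarrow> \<Phi> x i = 0) \<Longrightarrow> (\<And>i. i \<in> I \<Longrightarrow> x i = 0)"
  shows "\<exists>x. \<forall>i\<in>I. \<Phi> x i = b i"
proof -
  define e where "e j i = (if i = j then 1 else 0 :: 'c)" for j i :: 'a
  have zero: "\<Phi> (\<lambda>_. 0) i = 0" for i
    using linear[of "\<lambda>_. 0" "-1" "\<lambda>_. 0" i] by simp
  have expand: "\<Phi> (\<lambda>i. \<Sum>j\<in>S. x j * e j i) i = (\<Sum>j\<in>S. x j * \<Phi> (e j) i)" if "finite S" for S x i
    using that
  proof induction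
    case (insert a S)
    have "(\<lambda>i. \<Sum>j\<in>insert a S. x j * e j i) = (\<lambda>i. (\<Sum>j\<in>S. x j * e j i) + x a * e a i)"
      using insert by (simp add: add.commute)
    then have "\<Phi> (\<lambda>i. \<Sum>j\<in>insert a S. x j * e j i) i
        = \<Phi> (\<lambda>i. (\<Sum>j\<in>S. x j * e j i) + x a * e a i) i" by (rule arg_cong)
    then show ?case unfolding linear using insert by simp
  qed (simp add: zero)
  define A where "A i j = (case j of None \<Rightarrow> - b i | Some j \<Rightarrow> \<Phi> (e j) i)" for i j
  have "card I < card (insert None (Some ` I))"
    using assms(1) by (subst card_insert_disjoint) (auto simp: card_image)
  then obtain z where z: "\<exists>j\<in>insert None (Some ` I). z j \<noteq> 0"
    and Az: "\<forall>i\<in>I. (\<Sum>j\<in>insert None (Some ` I). A i j * z j) = 0"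
    using underdetermined_system_nontrivial_solution[of I "insert None (Some ` I)" A] assms(1) by auto
  let ?y = "\<lambda>i. \<Sum>j\<in>I. z (Some j) * e j i"
  have y: "?y i = z (Some i)" if "i \<in> I" for i
    using assms(1) that by (simp add: e_def if_distrib[of "\<lambda>t. _ * t"] cong: if_cong)
  have \<Phi>y: "\<Phi> ?y i = b i * z None" if "i \<in> I" for i
  proof -
    have "- b i * z None + (\<Sum>j\<in>I. \<Phi> (e j) i * z (Some j)) = 0"
      using Az that assms(1) by (simp add: A_def sum.reindex)
    then show ?thesis unfolding expand[OF assms(1)] by (simp add: mult.commute)
  qed
  have "z None \<noteq> 0"
  proof
    assume 0: "z None = 0"
    then have "?y i = 0" if "i \<in> I" for i using inj[of ?y i] \<Phi>y that by simp
    with y 0 z show False by auto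
  qed
  then have "\<Phi> (\<lambda>i. 0 + inverse (z None) * ?y i) i = b i" if "i \<in> I" for i
    unfolding linear zero \<Phi>y[OF that] by simp
  then show ?thesis by blast
qed

section \<open>Solvability of the step with frozen difference quotient\<close>

lemma diff_second_affine:
  "diff_second h (\<lambda>k. f k + c * g k) k = diff_second h f k + c * diff_second h g k"
proof -
  have "f (k + 1) + c * g (k + 1) - 2 * (f k + c * g k) + (f (k - 1) + c * g (k - 1))
      = (f (k + 1) - 2 * f k + f (k - 1)) + c * (g (k + 1) - 2 * g k + g (k - 1))"
    by (simp add: algebra_simps)
  then show ?thesis
    unfolding diff_second_def times_divide_eq_right add_divide_distrib[symmetric]
    by (rule arg_cong)
qed

text \<open>The boundary conditions of \<^const>\<open>lin_step\<close> solved for the ghost values.\<close>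

definition ext_dyn :: "real \<Rightarrow> real \<Rightarrow> nat \<Rightarrow> (int \<Rightarrow> real) \<Rightarrow> (int \<Rightarrow> real) \<Rightarrow> int \<Rightarrow> real" where
  "ext_dyn h \<tau> K d w k =
    (if k = -1 then w 1 - 2 * h / \<tau> * d 0
     else if k = int K + 1 then w (int K - 1) - 2 * h / \<tau> * d (int K) else w k)"

definition ext_even :: "nat \<Rightarrow> (int \<Rightarrow> real) \<Rightarrow> int \<Rightarrow> real" where
  "ext_even K p k = (if k = -1 then p 1 else if k = int K + 1 then p (int K - 1) else p k)"

text \<open>With all ghost values eliminated, \<open>P\<close> becomes, for \<open>K\<close> at
  least 1, a function of nodal data alone. What remains of the step is the evolution equation for
  the \<open>K + 1\<close> nodal increments.\<close>

definition potential ::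
    "real \<Rightarrow> real \<Rightarrow> real \<Rightarrow> nat \<Rightarrow> (int \<Rightarrow> real) \<Rightarrow> (int \<Rightarrow> real) \<Rightarrow> (int \<Rightarrow> real) \<Rightarrow> int \<Rightarrow> real" where
  "potential h \<gamma> \<tau> K r d w =
    ext_even K (\<lambda>k. - \<gamma> * diff_second h (ext_dyn h \<tau> K d w) k + r k)"

lemma potential_affine:
  "potential h \<gamma> \<tau> K (\<lambda>k. r k + c * r' k) (\<lambda>k. d k + c * d' k) (\<lambda>k. w k + c * w' k)
    = (\<lambda>k. potential h \<gamma> \<tau> K r d w k + c * potential h \<gamma> \<tau> K r' d' w' k)"
proof -
  have ext: "ext_dyn h \<tau> K (\<lambda>k. d k + c * d' k) (\<lambda>k. w k + c * w' k)
      = (\<lambda>k. ext_dyn h \<tau> K d w k + c * ext_dyn h \<tau> K d' w' k)"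
    by (rule ext) (simp add: ext_dyn_def algebra_simps add_divide_distrib)
  show ?thesis
    unfolding potential_def ext diff_second_affine
    by (simp add: ext_even_def fun_eq_iff algebra_simps)
qed

lemma lin_step_potential:
  assumes "h > 0" "K \<ge> 1" "\<tau> > 0"
    and "\<And>k. k \<in> {0..int K} \<Longrightarrow> d k = \<tau> * diff_second h (potential h \<gamma> \<tau> K r d w) k"
  shows "lin_step h \<gamma> \<tau> K r (ext_dyn h \<tau> K d w) d (potential h \<gamma> \<tau> K r d w)"
proof -
  have "\<tau> * diff_central h (ext_dyn h \<tau> K d w) 0 = d 0"
    and "- \<tau> * diff_central h (ext_dyn h \<tau> K d w) (int K) = d (int K)"
    using assms(1-3) by (auto simp: diff_central_def ext_dyn_def)
  moreover have "\<forall>k\<in>{0, int K}. diff_central h (potential h \<gamma> \<tau> K r d w) k = 0"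
    using assms(2) by (auto simp: diff_central_def potential_def ext_even_def)
  moreover have "\<forall>k\<in>{0..int K}. potential h \<gamma> \<tau> K r d w k
      = - \<gamma> * diff_second h (ext_dyn h \<tau> K d w) k + r k"
    by (auto simp: potential_def ext_even_def)
  ultimately show ?thesis using assms(4) unfolding lin_step_def by auto
qed

text \<open>The nodal increments solve a square linear system. Its injectivity is the stability
  estimate with zero data, whose smallness condition is void for \<open>M = 0\<close>; so no
  restriction on the time step arises.\<close>

lemma lin_step_solvable:
  assumes "h > 0" "K \<ge> 1" "\<tau> > 0" "\<gamma> > 0"
  shows "\<exists>V P. lin_step h \<gamma> \<tau> K r (midpoint_vec V U) (\<lambda>k. V k - U k) P"
proof -
  let ?p = "potential h \<gamma> \<tau> K"
  define \<Phi> where "\<Phi> d k = d k - \<tau> * diff_second h (?p (\<lambda>_. 0) d (\<lambda>k. d k / 2)) k" for d k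
  define b where "b k = \<tau> * diff_second h (?p r (\<lambda>_. 0) U) k" for k
  have "\<exists>d. \<forall>k\<in>{0..int K}. \<Phi> d k = b k"
  proof (rule linear_injective_imp_solvable)
    fix x y :: "int \<Rightarrow> real" and c :: real and i :: int
    have "?p (\<lambda>_. 0) (\<lambda>k. x k + c * y k) (\<lambda>k. (x k + c * y k) / 2)
        = (\<lambda>k. ?p (\<lambda>_. 0) x (\<lambda>k. x k / 2) k + c * ?p (\<lambda>_. 0) y (\<lambda>k. y k / 2) k)"
      using potential_affine[of h \<gamma> \<tau> K "\<lambda>_. 0" c "\<lambda>_. 0" x y "\<lambda>k. x k / 2" "\<lambda>k. y k / 2"]
      by (simp add: add_divide_distrib)
    then show "\<Phi> (\<lambda>i. x i + c * y i) i = \<Phi> x i + c * \<Phi> y i"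
      unfolding \<Phi>_def by (simp add: diff_second_affine algebra_simps)
  next
    fix d i assume d: "\<And>k. k \<in> {0..int K} \<Longrightarrow> \<Phi> d k = 0" and i: "i \<in> {0..int K}"
    \<comment> \<open>Doubling the extension makes \<open>?E / 2\<close> equal to the extended half
      increment at the ghost nodes too, while \<open>?E\<close> still agrees with \<open>d\<close>
      at the nodes.\<close>
    let ?E = "\<lambda>k. 2 * ext_dyn h \<tau> K d (\<lambda>k. d k / 2) k"
    have E: "?E k = d k" if "k \<in> {0..int K}" for k using that by (simp add: ext_dyn_def)
    have "lin_step h \<gamma> \<tau> K (\<lambda>_. 0) (ext_dyn h \<tau> K d (\<lambda>k. d k / 2)) d (?p (\<lambda>_. 0) d (\<lambda>k. d k / 2))"
      using d assms by (intro lin_step_potential) (auto simp: \<Phi>_def)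
    then have "lin_step h \<gamma> \<tau> K (\<lambda>_. 0) (\<lambda>k. ?E k / 2) ?E (?p (\<lambda>_. 0) d (\<lambda>k. d k / 2))"
      by (rule iffD1[OF lin_step_cong, rotated -1]) (use E in auto)
    then have "trap h K (\<lambda>k. (?E k)\<^sup>2) \<le> 1 / 5 * trap h K (\<lambda>k. 0\<^sup>2)"
      by (rule lin_step_stable[where M = 0, rotated 6]) (use assms in auto)
    moreover have "h / 2 * (?E i)\<^sup>2 \<le> trap h K (\<lambda>k. (?E k)\<^sup>2)"
      using assms i by (intro trap_ge_single) auto
    ultimately have "h / 2 * (?E i)\<^sup>2 \<le> 0" by (simp add: trap_const)
    then show "d i = 0" using assms(1) E[OF i] by (simp add: mult_le_0_iff)
  qed simp
  then obtain d where d: "\<And>k. k \<in> {0..int K} \<Longrightarrow> \<Phi> d k = b k" by blast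
  let ?w = "\<lambda>k. U k + d k / 2"
  \<comment> \<open>The new level is chosen so that its midpoint with \<open>U\<close> is the
    extension of \<open>?w\<close>, ghost values included.\<close>
  let ?V = "\<lambda>k. 2 * ext_dyn h \<tau> K d ?w k - U k"
  have "?p r d ?w = (\<lambda>k. ?p r (\<lambda>_. 0) U k + 1 * ?p (\<lambda>_. 0) d (\<lambda>k. d k / 2) k)"
    using potential_affine[of h \<gamma> \<tau> K r 1 "\<lambda>_. 0" "\<lambda>_. 0" d U "\<lambda>k. d k / 2"] by simp
  then have "d k = \<tau> * diff_second h (?p r d ?w) k" if "k \<in> {0..int K}" for k
    using d[OF that] by (simp only: diff_second_affine) (simp add: \<Phi>_def b_def algebra_simps)
  then have "lin_step h \<gamma> \<tau> K r (ext_dyn h \<tau> K d ?w) d (?p r d ?w)"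
    using assms by (intro lin_step_potential) auto
  then have "lin_step h \<gamma> \<tau> K r (midpoint_vec ?V U) (\<lambda>k. ?V k - U k) (?p r d ?w)"
    by (rule iffD1[OF lin_step_cong, rotated -1]) (auto simp: midpoint_vec_def ext_dyn_def)
  then show ?thesis by blast
qed

section \<open>Successive approximation in the trapezoidal norm\<close>

text \<open>The sum of squares sees only the nodes \<open>0\<close> to \<open>K\<close>, so the
  iterates are shown to converge there and the fixed-point equation is claimed only there. Since
  \<open>q\<close> contracts squares, nodal values of successive iterates differ by a multiple of
  \<open>sqrt q ^ m\<close>.\<close>

lemma trap_contraction_fixed_point:
  assumes "h > 0" "K \<ge> 1" "0 \<le> q" "q < 1"
    and contr: "\<And>x y. trap h K (\<lambda>k. (T x k - T y k)\<^sup>2) \<le> q * trap h K (\<lambda>k. (x k - y k)\<^sup>2)"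
  shows "\<exists>x. \<forall>k\<in>{0..int K}. T x k = x k"
proof -
  define X where "X m = (T ^^ m) (\<lambda>_. 0)" for m
  have X_Suc: "X (Suc m) = T (X m)" for m by (simp add: X_def)
  define a where "a = trap h K (\<lambda>k. (X 1 k - X 0 k)\<^sup>2)"
  have geo: "trap h K (\<lambda>k. (X (Suc m) k - X m k)\<^sup>2) \<le> q ^ m * a" for m
  proof (induction m)
    case (Suc m)
    then show ?case
      using contr[of "X (Suc m)" "X m"] mult_left_mono[OF Suc.IH assms(3)] unfolding X_Suc by simp
  qed (simp add: a_def)
  have single: "(f k)\<^sup>2 \<le> 2 / h * trap h K (\<lambda>k. (f k)\<^sup>2)" if "k \<in> {0..int K}" for f k
    using trap_ge_single[of h K k "\<lambda>k. (f k)\<^sup>2"] that assms(1,2) by (simp add: field_simps)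
  have "\<exists>l. (\<lambda>m. X m k) \<longlonglongrightarrow> l" if k: "k \<in> {0..int K}" for k
  proof -
    have "norm (X (Suc m) k - X m k) \<le> sqrt (2 / h * a) * sqrt q ^ m" for m
    proof -
      have "(X (Suc m) k - X m k)\<^sup>2 \<le> 2 / h * trap h K (\<lambda>k. (X (Suc m) k - X m k)\<^sup>2)"
        by (rule single[OF k])
      also have "\<dots> \<le> 2 / h * (q ^ m * a)" using geo assms(1) by (intro mult_left_mono) auto
      finally have "\<bar>X (Suc m) k - X m k\<bar> \<le> sqrt (2 / h * a * q ^ m)"
        by (metis real_sqrt_le_mono real_sqrt_abs mult.assoc mult.commute)
      then show ?thesis by (simp only: real_sqrt_mult real_sqrt_power real_norm_def)
    qed
    moreover have "summable (\<lambda>m. sqrt (2 / h * a) * sqrt q ^ m)"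
      using assms(3,4) by (intro summable_mult summable_geometric) auto
    ultimately have "summable (\<lambda>m. X (Suc m) k - X m k)"
      by (rule summable_comparison_test'[rotated])
    then have "(\<lambda>n. X n k - X 0 k) \<longlonglongrightarrow> (\<Sum>m. X (Suc m) k - X m k)"
      using summable_LIMSEQ sum_lessThan_telescope[of "\<lambda>m. X m k"] by fastforce
    then have "(\<lambda>n. X n k - X 0 k + X 0 k) \<longlonglongrightarrow> (\<Sum>m. X (Suc m) k - X m k) + X 0 k"
      by (intro tendsto_add tendsto_const)
    then show ?thesis by auto
  qed
  then obtain x where x: "\<And>k. k \<in> {0..int K} \<Longrightarrow> (\<lambda>m. X m k) \<longlonglongrightarrow> x k" by metis
  have "(\<lambda>m. trap h K (\<lambda>k. (x k - X m k)\<^sup>2)) \<longlonglongrightarrow> trap h K (\<lambda>k. (x k - x k)\<^sup>2)"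
    unfolding trap_def by (intro tendsto_intros x) auto
  then have lim0: "(\<lambda>m. trap h K (\<lambda>k. (x k - X m k)\<^sup>2)) \<longlonglongrightarrow> 0" by (simp add: trap_const)
  have "T x k = x k" if k: "k \<in> {0..int K}" for k
  proof -
    \<comment> \<open>Continuity of \<open>T\<close> enters through the contraction itself, which
      carries the convergence of \<open>X m\<close> to \<open>x\<close> over to
      \<open>T\<close>.\<close>
    have le: "(T x k - X (Suc m) k)\<^sup>2 \<le> 2 / h * (q * trap h K (\<lambda>k. (x k - X m k)\<^sup>2))" for m
      using single[OF k, of "\<lambda>k. T x k - X (Suc m) k"] contr[of x "X m"] assms(1)
      unfolding X_Suc by (meson divide_nonneg_pos less_imp_le mult_left_mono order_trans zero_le_numeral)
    have "(\<lambda>m. (T x k - X (Suc m) k)\<^sup>2) \<longlonglongrightarrow> (T x k - x k)\<^sup>2"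
      by (intro tendsto_intros LIMSEQ_Suc x k)
    moreover have "(\<lambda>m. 2 / h * (q * trap h K (\<lambda>k. (x k - X m k)\<^sup>2))) \<longlonglongrightarrow> 2 / h * (q * 0)"
      by (intro tendsto_intros lim0)
    ultimately have "(T x k - x k)\<^sup>2 \<le> 2 / h * (q * 0)"
      using le by (intro LIMSEQ_le) auto
    then show ?thesis by simp
  qed
  then show ?thesis by blast
qed

section \<open>Difference quotients and bounds on derivatives\<close>

lemma diff_quot_commute: "diff_quot F x y = diff_quot F y x"
  unfolding diff_quot_def by (metis minus_diff_eq minus_divide_divide)

lemma diff_quot_mult: "diff_quot F x y * (x - y) = F x - F y"
  by (simp add: diff_quot_def)

text \<open>Writing the quotient as the average of the derivative over the segment from
  \<open>u\<close> to \<open>v\<close> covers both branches of its definition, so that later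
  estimates need no case distinction.\<close>

lemma diff_quot_has_integral:
  assumes "\<And>x. (F has_real_derivative f x) (at x)"
  shows "((\<lambda>s. f (u + s * (v - u))) has_integral diff_quot F v u) {0..1}"
proof (cases "v = u")
  case True
  have "((\<lambda>s. f u) has_integral f u) {0..1 :: real}"
    using has_integral_const_real[of "f u" 0 1] by simp
  then show ?thesis using True DERIV_imp_deriv[OF assms, of u] by (simp add: diff_quot_def)
next
  case False
  have "((\<lambda>s. F (u + s * (v - u)) / (v - u)) has_real_derivative f (u + s * (v - u))) (at s within {0..1})"
    for s
    using False by (auto intro!: derivative_eq_intros DERIV_chain'[OF _ assms])
  then have "((\<lambda>s. f (u + s * (v - u))) has_integral
      (F (u + 1 * (v - u)) / (v - u) - F (u + 0 * (v - u)) / (v - u))) {0..1}"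
    by (intro fundamental_theorem_of_calculus) (auto simp: has_real_derivative_iff_has_vector_derivative)
  then show ?thesis using False by (simp add: diff_quot_def diff_divide_distrib)
qed

text \<open>The integrands differ by at most \<open>M * s * \<bar>v - v'\<bar>\<close>, and the
  integral of \<open>s\<close> over the unit interval gives the factor 1 / 2. Convexity keeps the
  segments inside \<open>S\<close>.\<close>

lemma diff_quot_lipschitz:
  assumes F: "\<And>x. (F has_real_derivative f x) (at x)"
    and f: "\<And>x y. x \<in> S \<Longrightarrow> y \<in> S \<Longrightarrow> \<bar>f x - f y\<bar> \<le> M * \<bar>x - y\<bar>"
    and "convex S" "u \<in> S" "v \<in> S" "v' \<in> S"
  shows "\<bar>diff_quot F v u - diff_quot F v' u\<bar> \<le> M / 2 * \<bar>v - v'\<bar>"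
proof -
  have le: "diff_quot F v u - diff_quot F v' u \<le> M / 2 * \<bar>v - v'\<bar>" if "v \<in> S" "v' \<in> S" for v v'
  proof (rule has_integral_le)
    show "((\<lambda>s. f (u + s * (v - u)) - f (u + s * (v' - u))) has_integral
        diff_quot F v u - diff_quot F v' u) {0..1}"
      by (intro has_integral_diff diff_quot_has_integral F)
    have "((\<lambda>s. M * \<bar>v - v'\<bar> * s) has_integral (M * \<bar>v - v'\<bar> * 1\<^sup>2 / 2 - M * \<bar>v - v'\<bar> * 0\<^sup>2 / 2)) {0..1}"
      by (rule fundamental_theorem_of_calculus)
        (auto simp: has_real_derivative_iff_has_vector_derivative[symmetric] intro!: derivative_eq_intros)
    then show "((\<lambda>s. M * \<bar>v - v'\<bar> * s) has_integral M / 2 * \<bar>v - v'\<bar>) {0..1}" by simp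
    fix s :: real assume s: "s \<in> {0..1}"
    have "u + s * (w - u) \<in> S" if "w \<in> S" for w
    proof -
      have "(1 - s) *\<^sub>R u + s *\<^sub>R w \<in> S"
        using assms(3,4) s that by (intro convexD_alt) auto
      then show ?thesis by (simp add: algebra_simps)
    qed
    then have "f (u + s * (v - u)) - f (u + s * (v' - u)) \<le> M * \<bar>(u + s * (v - u)) - (u + s * (v' - u))\<bar>"
      using f that by (meson abs_ge_self order_trans)
    also have "(u + s * (v - u)) - (u + s * (v' - u)) = s * (v - v')" by (simp add: algebra_simps)
    finally show "f (u + s * (v - u)) - f (u + s * (v' - u)) \<le> M * \<bar>v - v'\<bar> * s"
      using s by (simp add: abs_mult mult_ac)
  qed
  show ?thesis
    using le[OF assms(5,6)] le[OF assms(6,5)] unfolding abs_minus_commute[of v' v] by linarith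
qed

lemma C_cont_diff_deriv:
  assumes "C_cont_diff n F" "m < n"
  shows "((deriv ^^ m) F has_real_derivative (deriv ^^ Suc m) F x) (at x)"
proof -
  have "(deriv ^^ m) F differentiable (at x)"
    using assms by (auto simp: C_cont_diff_def differentiable_on_def)
  then show ?thesis by (simp add: real_differentiable_def DERIV_deriv_iff_real_differentiable)
qed

text \<open>Continuity on a compact interval makes the image bounded above; only then is the
  \<open>SUP\<close> known to be an upper bound.\<close>

lemma abs_le_max_abs_deriv:
  assumes "C_cont_diff n F" "m \<le> n" "\<bar>x\<bar> \<le> R"
  shows "\<bar>(deriv ^^ m) F x\<bar> \<le> max_abs_deriv m F R"
proof -
  have "continuous_on UNIV ((deriv ^^ m) F)"
  proof (cases "m = n")
    case False
    then show ?thesis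
      using C_cont_diff_deriv[OF assms(1), of m] assms(2)
      by (metis DERIV_continuous_on le_neq_implies_less has_field_derivative_at_within)
  qed (use assms in \<open>auto simp: C_cont_diff_def\<close>)
  then have "continuous_on {-R..R} (\<lambda>x. \<bar>(deriv ^^ m) F x\<bar>)"
    by (intro continuous_on_rabs) (rule continuous_on_subset, auto)
  then have "compact ((\<lambda>x. \<bar>(deriv ^^ m) F x\<bar>) ` {-R..R})"
    by (rule compact_continuous_image) simp
  moreover have "{\<xi>. \<bar>\<xi>\<bar> \<le> R} = {-R..R}" by auto
  ultimately show ?thesis
    unfolding max_abs_deriv_def using assms(3)
    by (intro cSUP_upper) (auto intro: bounded_imp_bdd_above compact_imp_bounded)
qed

lemma deriv_lipschitz:
  assumes "C_cont_diff n F" "2 \<le> n" "\<bar>x\<bar> \<le> R" "\<bar>y\<bar> \<le> R"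
  shows "\<bar>deriv F x - deriv F y\<bar> \<le> max_abs_deriv 2 F R * \<bar>x - y\<bar>"
proof -
  have "norm (deriv F x - deriv F y) \<le> max_abs_deriv 2 F R * norm (x - y)"
  proof (rule field_differentiable_bound[of "{-R..R}" _ "(deriv ^^ 2) F"])
    fix z assume z: "z \<in> {-R..R}"
    show "(deriv F has_real_derivative (deriv ^^ 2) F z) (at z within {-R..R})"
      using C_cont_diff_deriv[OF assms(1), of 1 z] assms(2)
      by (simp add: has_field_derivative_at_within numeral_2_eq_2)
    show "norm ((deriv ^^ 2) F z) \<le> max_abs_deriv 2 F R"
      using abs_le_max_abs_deriv[OF assms(1,2), of z R] z by auto
  qed (use assms in auto)
  then show ?thesis by simp
qed

lemma abs_le_double: "\<bar>x\<bar> \<le> c \<Longrightarrow> \<bar>x\<bar> \<le> 2 * c" for x c :: real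
  by linarith

section \<open>A priori bounds for the scheme\<close>

lemma scheme_step_iff_lin_step:
  assumes "\<Delta>t > 0"
  shows "scheme_step L \<gamma> K \<Delta>t F U V P \<longleftrightarrow>
    lin_step (mesh L K) \<gamma> \<Delta>t K (\<lambda>k. diff_quot F (V k) (U k)) (midpoint_vec V U) (\<lambda>k. V k - U k) P"
  using assms by (auto simp: scheme_step_def lin_step_def field_simps)

text \<open>The stencils at the nodes reach no further than the ghost indices, so any solution can
  be cut down to one in \<open>grid_vec K\<close>.\<close>

lemma scheme_step_restrict:
  "scheme_step L \<gamma> K \<Delta>t F U (restrict V {-1..int K + 1}) (restrict P {-1..int K + 1})
    \<longleftrightarrow> scheme_step L \<gamma> K \<Delta>t F U V P"
  by (simp add: scheme_step_def diff_second_def diff_central_def midpoint_vec_def)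

lemma scheme_step_mass:
  assumes "L > 0" "K \<ge> 1" "\<Delta>t > 0" "scheme_step L \<gamma> K \<Delta>t F U V P"
  shows "mass_d L K V = mass_d L K U"
proof -
  have "mesh L K \<noteq> 0" using assms by (simp add: mesh_def)
  from lin_step_mass[OF this iffD1[OF scheme_step_iff_lin_step[OF assms(3)] assms(4)]]
  show ?thesis unfolding trap_eq_mass[OF assms(2)] trap_diff by simp
qed

text \<open>The difference quotient times the increment is exactly the increment of
  \<open>F\<close>, so the energy identity becomes an energy balance with nonnegative
  dissipation.\<close>

lemma scheme_step_energy:
  assumes "L > 0" "K \<ge> 1" "\<Delta>t > 0" "\<gamma> > 0" "scheme_step L \<gamma> K \<Delta>t F U V P"
  shows "energy_d L \<gamma> K F V \<le> energy_d L \<gamma> K F U"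
proof -
  let ?h = "mesh L K"
  have h: "?h > 0" using assms by (simp add: mesh_def)
  have "0 \<le> \<Delta>t * dirichlet ?h K P P" using assms(3) h by (simp add: dirichlet_nonneg)
  moreover have "0 \<le> \<gamma> / \<Delta>t * ((V 0 - U 0)\<^sup>2 + (V (int K) - U (int K))\<^sup>2)" using assms by simp
  moreover have "\<Delta>t * dirichlet ?h K P P + \<gamma> * (1 / 2 * (dirichlet ?h K V V - dirichlet ?h K U U))
      + \<gamma> / \<Delta>t * ((V 0 - U 0)\<^sup>2 + (V (int K) - U (int K))\<^sup>2)
      + (trap ?h K (\<lambda>k. F (V k)) - trap ?h K (\<lambda>k. F (U k))) = 0"
    using lin_step_energy[OF _ assms(3) iffD1[OF scheme_step_iff_lin_step[OF assms(3)] assms(5)]] h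
    unfolding dirichlet_midpoint diff_quot_mult trap_diff by simp
  ultimately show ?thesis unfolding energy_eq by (simp add: algebra_simps)
qed

text \<open>The potential energy is at least \<open>- L\<close> times the constant in
  \<open>B0\<close>, so an energy bound leaves a bound on the gradient part.\<close>

lemma dirichlet_le_B0:
  assumes "L > 0" "K \<ge> 1" "\<gamma> > 0" "bdd_below (range F)"
    and "energy_d L \<gamma> K F V \<le> energy_d L \<gamma> K F U0"
  shows "dirichlet (mesh L K) K V V \<le> (B0 L \<gamma> K F U0)\<^sup>2" "0 \<le> B0 L \<gamma> K F U0"
proof -
  let ?h = "mesh L K"
  let ?m = "\<bar>min (INF \<xi>. F \<xi>) 0\<bar>"
  have h: "?h > 0" "?h * real K = L" using assms by (simp_all add: mesh_def)
  have "- ?m \<le> F x" for x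
    using cINF_lower[OF assms(4), of x] by auto
  then have "trap ?h K (\<lambda>k. - ?m) \<le> trap ?h K (\<lambda>k. F (V k))"
    using h(1) by (intro trap_mono) auto
  then have "- (L * ?m) \<le> trap ?h K (\<lambda>k. F (V k))" unfolding trap_const h(2) by simp
  then have "\<gamma> / 2 * dirichlet ?h K V V \<le> energy_d L \<gamma> K F U0 + L * ?m"
    using assms(5) unfolding energy_eq[of _ _ _ _ V] by linarith
  then have *: "dirichlet ?h K V V \<le> 2 / \<gamma> * (energy_d L \<gamma> K F U0 + L * ?m)"
    using assms(3) by (simp add: field_simps)
  \<comment> \<open>A nonnegative radicand is what makes the square of \<open>B0\<close> equal to
    it.\<close>
  then have "0 \<le> 2 / \<gamma> * (energy_d L \<gamma> K F U0 + L * ?m)"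
    using dirichlet_nonneg[of ?h K V] h(1) by linarith
  then show "dirichlet ?h K V V \<le> (B0 L \<gamma> K F U0)\<^sup>2" "0 \<le> B0 L \<gamma> K F U0"
    using * unfolding B0_def by simp_all
qed

lemma sup_bound_mesh:
  assumes "L > 0" "K \<ge> 1" "k \<in> {0..int K}" "0 \<le> b" "dirichlet (mesh L K) K V V \<le> b\<^sup>2"
  shows "\<bar>V k\<bar> \<le> 1 / L * \<bar>mass_d L K V\<bar> + sqrt L * b"
proof -
  have h: "mesh L K > 0" "mesh L K * real K = L" using assms by (simp_all add: mesh_def)
  have "sqrt (L * dirichlet (mesh L K) K V V) \<le> sqrt (L * b\<^sup>2)"
    using assms by (intro real_sqrt_le_mono mult_left_mono) auto
  also have "\<dots> = sqrt L * b" using assms(4) by (simp add: real_sqrt_mult)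
  finally show ?thesis
    using sup_bound[OF h(1) assms(2,3), of V] unfolding h(2) trap_eq_mass[OF assms(2)] by simp
qed

lemma diff_quot_lipschitz_max:
  assumes "C_cont_diff n F" "2 \<le> n" "\<bar>v\<bar> \<le> R" "\<bar>v'\<bar> \<le> R" "\<bar>u\<bar> \<le> R"
  shows "\<bar>diff_quot F v u - diff_quot F v' u\<bar> \<le> max_abs_deriv 2 F R / 2 * \<bar>v - v'\<bar>"
proof (rule diff_quot_lipschitz[where S = "{-R..R}" and f = "deriv F"])
  show "(F has_real_derivative deriv F x) (at x)" for x
    using C_cont_diff_deriv[OF assms(1), of 0 x] assms(2) by simp
  show "\<bar>deriv F x - deriv F y\<bar> \<le> max_abs_deriv 2 F R * \<bar>x - y\<bar>"
    if "x \<in> {-R..R}" "y \<in> {-R..R}" for x y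
    using deriv_lipschitz[OF assms(1,2), of x R y] that by auto
qed (use assms in auto)

section \<open>Uniqueness and existence for one time step\<close>

text \<open>The difference of two solutions is a linear step whose data respond to that difference
  itself, so its squared norm is at most a fifth of itself. This settles the nodes; the boundary
  conditions then settle the ghost values.\<close>

lemma scheme_step_unique:
  assumes "L > 0" "K \<ge> 1" "\<Delta>t > 0" "\<gamma> > 0" "C_cont_diff n F" "2 \<le> n" "0 \<le> R"
    and small: "3 / 2 * max_abs_deriv 2 F R * sqrt (\<Delta>t / (2 * \<gamma>)) < 1"
    and bounds: "\<And>k. k \<in> {0..int K} \<Longrightarrow> \<bar>U k\<bar> \<le> R \<and> \<bar>V k\<bar> \<le> R \<and> \<bar>V' k\<bar> \<le> R"
    and "scheme_step L \<gamma> K \<Delta>t F U V P" "scheme_step L \<gamma> K \<Delta>t F U V' P'"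
    and "V \<in> grid_vec K" "V' \<in> grid_vec K"
  shows "V = V'"
proof -
  let ?h = "mesh L K" and ?M = "max_abs_deriv 2 F R"
  let ?E = "\<lambda>k. V k - V' k"
  have h: "?h > 0" using assms by (simp add: mesh_def)
  have M: "?M \<ge> 0" using abs_le_max_abs_deriv[OF assms(5,6), of 0 R] assms(7) by force
  have E: "lin_step ?h \<gamma> \<Delta>t K (\<lambda>k. diff_quot F (V k) (U k) - diff_quot F (V' k) (U k))
      (\<lambda>k. ?E k / 2) ?E (\<lambda>k. P k - P' k)"
    using lin_step_diff[OF assms(10,11)[unfolded scheme_step_iff_lin_step[OF assms(3)]]]
    by (simp add: midpoint_vec_def diff_divide_distrib[symmetric])
  have "trap ?h K (\<lambda>k. (?E k)\<^sup>2) \<le> 1 / 5 * trap ?h K (\<lambda>k. (?E k)\<^sup>2)"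
    by (rule lin_step_stable[OF h assms(2-4) M small E])
      (use bounds diff_quot_lipschitz_max[OF assms(5,6)] in auto)
  then have 0: "trap ?h K (\<lambda>k. (?E k)\<^sup>2) \<le> 0" by simp
  have inner: "V k = V' k" if "k \<in> {0..int K}" for k
  proof -
    have "?h / 2 * (?E k)\<^sup>2 \<le> trap ?h K (\<lambda>k. (?E k)\<^sup>2)"
      using h assms(2) that by (intro trap_ge_single) auto
    then have "?h * (?E k)\<^sup>2 \<le> 0" using 0 by simp
    then show ?thesis using h by (simp add: mult_le_0_iff)
  qed
  \<comment> \<open>The increments agree at both ends, so the dynamic boundary conditions tie each
    ghost value to the neighbouring value at \<open>1\<close> or \<open>int K - 1\<close>, a node
    because \<open>K\<close> is at least 1.\<close>
  have "diff_central ?h (\<lambda>k. ?E k / 2) 0 = 0" "diff_central ?h (\<lambda>k. ?E k / 2) (int K) = 0"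
    using E inner[of 0] inner[of "int K"] assms(3) by (auto simp: lin_step_def)
  then have "V (-1) = V' (-1)" "V (int K + 1) = V' (int K + 1)"
    using h inner[of 1] inner[of "int K - 1"] assms(2) by (auto simp: diff_central_def)
  then have "V k = V' k" if "k \<in> {-1..int K + 1}" for k
    using inner[of k] that by (cases "k = -1 \<or> k = int K + 1") auto
  then show ?thesis
    using assms(12,13) unfolding grid_vec_def by (intro PiE_ext) auto
qed

text \<open>The difference quotient is truncated outside \<open>[-R, R]\<close>, which makes the solution map of the
  linear step a contraction on the whole space; the gradient bound then shows that the truncation
  is not active at the fixed point.\<close>

lemma scheme_step_exists:
  assumes "L > 0" "K \<ge> 1" "\<Delta>t > 0" "\<gamma> > 0" "C_cont_diff n F" "2 \<le> n"
    and b: "0 \<le> b" "dirichlet (mesh L K) K U U \<le> b\<^sup>2"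
    and R: "R = 2 * (1 / L * \<bar>mass_d L K U\<bar> + sqrt L * b)"
    and small: "3 / 2 * max_abs_deriv 2 F R * sqrt (\<Delta>t / (2 * \<gamma>)) < 1"
  shows "\<exists>V P. V \<in> grid_vec K \<and> P \<in> grid_vec K \<and> scheme_step L \<gamma> K \<Delta>t F U V P"
proof -
  let ?h = "mesh L K" and ?M = "max_abs_deriv 2 F R"
  have h: "?h > 0" using assms by (simp add: mesh_def)
  have R0: "R \<ge> 0" using assms(1) b(1) unfolding R by simp
  have M: "?M \<ge> 0" using abs_le_max_abs_deriv[OF assms(5,6), of 0 R] R0 by force
  have U: "\<bar>U k\<bar> \<le> R" if "k \<in> {0..int K}" for k
    unfolding R by (rule abs_le_double[OF sup_bound_mesh[OF assms(1,2) that b]])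
  define clamp where "clamp x = max (- R) (min R x)" for x :: real
  have clamp: "\<bar>clamp x\<bar> \<le> R" "\<bar>clamp x - clamp y\<bar> \<le> \<bar>x - y\<bar>" for x y
    using R0 by (auto simp: clamp_def max_def min_def)
  have clamp_id: "clamp x = x" if "\<bar>x\<bar> \<le> R" for x using that by (auto simp: clamp_def)
  let ?G = "\<lambda>x k. diff_quot F (clamp (x k)) (U k)"
  have "\<forall>x. \<exists>V P. lin_step ?h \<gamma> \<Delta>t K (?G x) (midpoint_vec V U) (\<lambda>k. V k - U k) P"
    by (intro allI lin_step_solvable[OF h assms(2-4)])
  from choice[OF this] obtain T
    where T: "\<forall>x. \<exists>P. lin_step ?h \<gamma> \<Delta>t K (?G x) (midpoint_vec (T x) U) (\<lambda>k. T x k - U k) P" ..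
  from choice[OF T] obtain Q
    where "\<forall>x. lin_step ?h \<gamma> \<Delta>t K (?G x) (midpoint_vec (T x) U) (\<lambda>k. T x k - U k) (Q x)" ..
  then have step: "lin_step ?h \<gamma> \<Delta>t K (?G x) (midpoint_vec (T x) U) (\<lambda>k. T x k - U k) (Q x)"
    for x by (rule spec)
  have "\<exists>x. \<forall>k\<in>{0..int K}. T x k = x k"
  proof (rule trap_contraction_fixed_point[OF h assms(2), of "1 / 5"])
    fix x y
    have "lin_step ?h \<gamma> \<Delta>t K (\<lambda>k. ?G x k - ?G y k) (\<lambda>k. (T x k - T y k) / 2)
        (\<lambda>k. T x k - T y k) (\<lambda>k. Q x k - Q y k)"
      using lin_step_diff[OF step[of x] step[of y]]
      by (simp add: midpoint_vec_def diff_divide_distrib[symmetric])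
    then show "trap ?h K (\<lambda>k. (T x k - T y k)\<^sup>2) \<le> 1 / 5 * trap ?h K (\<lambda>k. (x k - y k)\<^sup>2)"
    proof (rule lin_step_stable[OF h assms(2-4) M small])
      fix k assume "k \<in> {0..int K}"
      then have "\<bar>?G x k - ?G y k\<bar> \<le> ?M / 2 * \<bar>clamp (x k) - clamp (y k)\<bar>"
        using clamp(1) U by (intro diff_quot_lipschitz_max[OF assms(5,6)]) auto
      also have "\<dots> \<le> ?M / 2 * \<bar>x k - y k\<bar>" using clamp(2) M by (intro mult_left_mono) auto
      finally show "\<bar>?G x k - ?G y k\<bar> \<le> ?M / 2 * \<bar>x k - y k\<bar>" .
    qed
  qed auto
  then obtain x where x: "\<And>k. k \<in> {0..int K} \<Longrightarrow> T x k = x k" by blast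
  define V where "V = T x"
  have V: "lin_step ?h \<gamma> \<Delta>t K (?G V) (midpoint_vec V U) (\<lambda>k. V k - U k) (Q x)"
    using step[of x] unfolding V_def[symmetric]
    by (rule iffD1[OF lin_step_cong, rotated -1]) (use x in \<open>auto simp: V_def\<close>)
  have "dirichlet ?h K V V \<le> 4 * dirichlet ?h K U U"
  proof (rule lin_step_gradient_bound[OF h assms(3,4) M small V])
    fix k assume k: "k \<in> {0..<int K}"
    then have k01: "k \<in> {0..int K}" "k + 1 \<in> {0..int K}" by auto
    \<comment> \<open>The two arguments are changed one at a time; symmetry of the quotient brings
      the second change into the first slot, where the Lipschitz estimate applies.\<close>
    have "\<bar>?G V (k + 1) - ?G V k\<bar>
        \<le> \<bar>diff_quot F (clamp (V (k + 1))) (U (k + 1)) - diff_quot F (clamp (V k)) (U (k + 1))\<bar>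
          + \<bar>diff_quot F (U (k + 1)) (clamp (V k)) - diff_quot F (U k) (clamp (V k))\<bar>"
      unfolding diff_quot_commute[of F "clamp (V k)"] diff_quot_commute[of F "clamp (V (k + 1))"] by linarith
    also have "\<dots> \<le> ?M / 2 * \<bar>clamp (V (k + 1)) - clamp (V k)\<bar> + ?M / 2 * \<bar>U (k + 1) - U k\<bar>"
      using clamp(1) U[OF k01(1)] U[OF k01(2)]
      by (intro add_mono diff_quot_lipschitz_max[OF assms(5,6)]) auto
    also have "\<dots> \<le> ?M / 2 * \<bar>V (k + 1) - V k\<bar> + ?M / 2 * \<bar>U (k + 1) - U k\<bar>"
      using clamp(2) M by (intro add_mono mult_left_mono) auto
    finally show "\<bar>?G V (k + 1) - ?G V k\<bar> \<le> ?M / 2 * (\<bar>V (k + 1) - V k\<bar> + \<bar>U (k + 1) - U k\<bar>)"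
      by (simp add: distrib_left)
  qed
  then have grad: "dirichlet ?h K V V \<le> (2 * b)\<^sup>2" using b(2) by (simp add: power_mult_distrib)
  have mass: "mass_d L K V = mass_d L K U"
    using lin_step_mass[OF _ V] h unfolding trap_eq_mass[OF assms(2)] trap_diff by simp
  have "\<bar>V k\<bar> \<le> R" if "k \<in> {0..int K}" for k
  proof -
    \<comment> \<open>The mass is unchanged and the gradient bound doubles, so the whole bound at
      most doubles and stays within \<open>R\<close>.\<close>
    have "\<bar>V k\<bar> \<le> 1 / L * \<bar>mass_d L K U\<bar> + sqrt L * (2 * b)"
      using sup_bound_mesh[OF assms(1,2) that _ grad] b(1) unfolding mass by simp
    also have "\<dots> \<le> 2 * (1 / L * \<bar>mass_d L K U\<bar>) + sqrt L * (2 * b)"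
    proof -
      have "0 \<le> 1 / L * \<bar>mass_d L K U\<bar>" using assms(1) by simp
      then show ?thesis by (simp only: mult_2 add_le_cancel_right le_add_same_cancel1)
    qed
    also have "\<dots> = R" unfolding R by (simp add: algebra_simps)
    finally show ?thesis .
  qed
  then have "scheme_step L \<gamma> K \<Delta>t F U V (Q x)"
    unfolding scheme_step_iff_lin_step[OF assms(3)] using V
    by (elim iffD1[OF lin_step_cong, rotated -1]) (auto simp: clamp_id)
  then show ?thesis
    using scheme_step_restrict[of L \<gamma> K \<Delta>t F U V "Q x"] unfolding grid_vec_def
    by (metis restrict_PiE_iff UNIV_I)
qed

section \<open>Passage from one step to all time levels\<close>

theorem theorem4p1:
  fixes L \<gamma> \<Delta>t :: real and K :: nat and F :: "real \<Rightarrow> real" and U0 :: "int \<Rightarrow> real"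
  assumes "L > 0" and "\<gamma> > 0" and "K \<ge> 1" and "\<Delta>t > 0"
    and "bdd_below (range F)"
    and "C_cont_diff 3 F"
    and "U0 \<in> grid_vec K"
    and "max (3 / 2 * max_abs_deriv 2 F (2 * B0_tilde L \<gamma> K F U0))
             (1 / 2 * max_abs_deriv 2 F (2 * B0_tilde L \<gamma> K F U0)
              + 5 * sqrt L * B0 L \<gamma> K F U0 / 6 * max_abs_deriv 3 F (2 * B0_tilde L \<gamma> K F U0))
           * sqrt (\<Delta>t / (2 * \<gamma>)) < 1"
  shows "\<exists>!U :: nat \<Rightarrow> int \<Rightarrow> real.
           U 0 = U0 \<and> (\<forall>n. U n \<in> grid_vec K) \<and>
           (\<exists>P. (\<forall>n. P n \<in> grid_vec K) \<and> scheme L \<gamma> K \<Delta>t F U P)"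
proof -
  let ?b = "B0 L \<gamma> K F U0" and ?R = "2 * B0_tilde L \<gamma> K F U0"
  let ?step = "scheme_step L \<gamma> K \<Delta>t F"
  have "3 / 2 * max_abs_deriv 2 F ?R * sqrt (\<Delta>t / (2 * \<gamma>))
      \<le> max (3 / 2 * max_abs_deriv 2 F ?R)
          (1 / 2 * max_abs_deriv 2 F ?R + 5 * sqrt L * ?b / 6 * max_abs_deriv 3 F ?R)
        * sqrt (\<Delta>t / (2 * \<gamma>))"
    using assms(2,4) by (intro mult_right_mono) auto
  with assms(8) have small: "3 / 2 * max_abs_deriv 2 F ?R * sqrt (\<Delta>t / (2 * \<gamma>)) < 1" by linarith
  have C2: "C_cont_diff 3 F" "(2 :: nat) \<le> 3" using assms(6) by auto
  \<comment> \<open>This invariant yields the same radius \<open>?R\<close> at every level, so a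
    single smallness condition serves all steps.\<close>
  define good where "good U \<longleftrightarrow> U \<in> grid_vec K \<and> mass_d L K U = mass_d L K U0
      \<and> energy_d L \<gamma> K F U \<le> energy_d L \<gamma> K F U0" for U
  have good0: "good U0" using assms(7) by (simp add: good_def)
  have good_step: "good V" if "good U" "?step U V P" "V \<in> grid_vec K" for U V P
    using that scheme_step_mass[OF assms(1,3,4) that(2)]
      scheme_step_energy[OF assms(1,3,4,2) that(2)]
    by (auto simp: good_def)
  have good_grad: "dirichlet (mesh L K) K U U \<le> ?b\<^sup>2" "0 \<le> ?b" if "good U" for U
    using dirichlet_le_B0[OF assms(1,3,2,5)] that by (auto simp: good_def)
  have R: "?R = 2 * (1 / L * \<bar>mass_d L K U\<bar> + sqrt L * ?b)" if "good U" for U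
    using that by (simp add: B0_tilde_def good_def)
  have R0: "0 \<le> ?R"
    using assms(1) good_grad(2)[OF good0] unfolding B0_tilde_def by simp
  have good_bound: "\<bar>U k\<bar> \<le> ?R" if "good U" "k \<in> {0..int K}" for U k
    unfolding R[OF that(1)]
    by (rule abs_le_double[OF sup_bound_mesh[OF assms(1,3) that(2) good_grad(2,1)[OF that(1)]]])
  have ex: "\<exists>V. \<exists>P. V \<in> grid_vec K \<and> P \<in> grid_vec K \<and> ?step U V P" if "good U" for U
    by (rule scheme_step_exists[OF assms(1,3,4,2) C2 good_grad(2,1)[OF that] R[OF that] small])
  \<comment> \<open>Competing solutions need no assumed bound: any grid vector solving a step from a
    good level is good, hence bounded by \<open>?R\<close>.\<close>
  have uniq: "V = V'"
    if "good U" "?step U V P" "?step U V' P'" "V \<in> grid_vec K" "V' \<in> grid_vec K" for U V V' P P'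
    by (rule scheme_step_unique[OF assms(1,3,4,2) C2 R0 small _ that(2-5)])
      (use that good_step good_bound in blast)
  obtain U where U: "U 0 = U0" "\<And>n. good (U n)"
    and U_step: "\<And>n. \<exists>P. P \<in> grid_vec K \<and> ?step (U n) (U (Suc n)) P"
  proof -
    \<comment> \<open>Dependent choice of the levels; the clause for \<open>n = 0\<close> pins the
      start to \<open>U0\<close>.\<close>
    have "\<exists>U. \<forall>n. (good (U n) \<and> (n = 0 \<longrightarrow> U n = U0)) \<and> (\<exists>P. P \<in> grid_vec K \<and> ?step (U n) (U (Suc n)) P)"
      by (rule dependent_nat_choice) (use good0 ex good_step in blast)+
    then show ?thesis using that by blast
  qed
  obtain P where "\<And>n. P n \<in> grid_vec K" "\<And>n. ?step (U n) (U (Suc n)) (P n)"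
    using U_step by metis
  with U have sol: "U 0 = U0 \<and> (\<forall>n. U n \<in> grid_vec K) \<and>
      (\<exists>P. (\<forall>n. P n \<in> grid_vec K) \<and> scheme L \<gamma> K \<Delta>t F U P)"
    unfolding good_def scheme_def by blast
  show ?thesis
  proof (rule ex1I[where a = U], rule sol)
    fix U' assume U': "U' 0 = U0 \<and> (\<forall>n. U' n \<in> grid_vec K) \<and>
      (\<exists>P. (\<forall>n. P n \<in> grid_vec K) \<and> scheme L \<gamma> K \<Delta>t F U' P)"
    have "U' n = U n" for n
    proof (induction n)
      case (Suc n)
      then show ?case
        using U' U U_step[of n] uniq unfolding scheme_def good_def by metis
    qed (use U U' in simp)
    then show "U' = U" by blast
  qed
qed

end
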